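(* The Alexander module of Thompson's quandle $P$ is isomorphic, as a $\mathbb{Z}[q^{\pm1}]$-module, to $\mathbb{Z}[q^{\pm1}]\oplus\mathbb{Z}$, where $\mathbb{Z}=\mathbb{Z}[q^{\pm1}]/(1-q)$, i.e. $q$ acts as the identity on the summand $\mathbb{Z}$.
   Context: A quandle is a set $Q$ with a binary operation $\rhd$ such that for every $x\in Q$ the left multiplication $y\mapsto x\rhd y$ is bijective, $x\rhd(y\rhd z)=(x\rhd y)\rhd(x\rhd z)$ for all $x,y,z$, and $x\rhd x=x$ for all $x$. Thompson's quandle $P$ is the quandle with generators $p_0,p_1,p_2,\dots$ and relations $p_j\rhd p_k=p_{k+1}$ for all $0\leqslant j<k$. The Alexander module of a quandle $Q$ given by a presentation $\langle S\mid R\rangle$ is the $\mathbb{Z}[q^{\pm1}]$-module generated by $S$ subject to the relations obtained from $R$ by replacing each $x\rhd y$ with $(1-q)x+qy$; it does not depend, up to isomorphism, on the chosen presentation of $Q$. *)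

theory Defs
  imports
    "HOL-Algebra.Module"
    "HOL-Algebra.AbelCoset"
    "HOL-Algebra.Algebraic_Closure_Type"
    "HOL-Library.Poly_Mapping"
begin

section \<open>Quandles\<close>

record 'a quandle = "'a partial_object" +
  act :: "'a \<Rightarrow> 'a \<Rightarrow> 'a" (infixr \<open>\<rhd>\<index>\<close> 70)

locale quandle =
  fixes Q (structure)
  assumes bij_act: "x \<in> carrier Q \<Longrightarrow> bij_betw (\<lambda>y. x \<rhd> y) (carrier Q) (carrier Q)"
    and act_distrib: "\<lbrakk>x \<in> carrier Q; y \<in> carrier Q; z \<in> carrier Q\<rbrakk>
      \<Longrightarrow> x \<rhd> (y \<rhd> z) = (x \<rhd> y) \<rhd> (x \<rhd> z)"
    and act_idem: "x \<in> carrier Q \<Longrightarrow> x \<rhd> x = x"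

definition quandle_hom :: "('a, 'm) quandle_scheme \<Rightarrow> ('b, 'n) quandle_scheme \<Rightarrow> ('a \<Rightarrow> 'b) set"
  where "quandle_hom Q Q' = {h \<in> carrier Q \<rightarrow> carrier Q'.
    \<forall>x\<in>carrier Q. \<forall>y\<in>carrier Q. h (x \<rhd>\<^bsub>Q\<^esub> y) = h x \<rhd>\<^bsub>Q'\<^esub> h y}"

definition quandle_isomorphic :: "('a, 'm) quandle_scheme \<Rightarrow> ('b, 'n) quandle_scheme \<Rightarrow> bool"
    (infix \<open>\<cong>\<^sub>Q\<close> 50)
  where "Q \<cong>\<^sub>Q Q' \<longleftrightarrow> (\<exists>h\<in>quandle_hom Q Q'. bij_betw h (carrier Q) (carrier Q'))"


section \<open>Quandle presentations\<close>

text \<open>Words in generators from the type \<^typ>\<open>'s\<close>. The word \<open>Inv_Act u v\<close> stands for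
  the unique \<open>w\<close> with \<open>Act u w = v\<close>; a quandle generated by a set consists of
  the values of such words.\<close>

datatype 's quandle_word =
    Gen 's
  | Act "'s quandle_word" "'s quandle_word"
  | Inv_Act "'s quandle_word" "'s quandle_word"

inductive quandle_cong ::
    "('s quandle_word \<times> 's quandle_word) set \<Rightarrow> 's quandle_word \<Rightarrow> 's quandle_word \<Rightarrow> bool"
  for R where
    rel: "(u, v) \<in> R \<Longrightarrow> quandle_cong R u v"
  | refl: "quandle_cong R u u"
  | sym: "quandle_cong R u v \<Longrightarrow> quandle_cong R v u"
  | trans: "quandle_cong R u v \<Longrightarrow> quandle_cong R v w \<Longrightarrow> quandle_cong R u w"
  | act: "quandle_cong R u u' \<Longrightarrow> quandle_cong R v v' \<Longrightarrow> quandle_cong R (Act u v) (Act u' v')"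
  | inv_act: "quandle_cong R u u' \<Longrightarrow> quandle_cong R v v'
      \<Longrightarrow> quandle_cong R (Inv_Act u v) (Inv_Act u' v')"
  | act_inv: "quandle_cong R (Act u (Inv_Act u v)) v"
  | inv_of_act: "quandle_cong R (Inv_Act u (Act u v)) v"
  | distrib: "quandle_cong R (Act u (Act v w)) (Act (Act u v) (Act u w))"
  | idem: "quandle_cong R (Act u u) u"

text \<open>The quandle \<open>\<langle>S | R\<rangle>\<close>, where \<open>S\<close> is the type \<^typ>\<open>'s\<close> and a pair \<open>(u, v) \<in> R\<close> is
  the relation \<open>u = v\<close>. Generating sets given as types are nonempty; this only leaves out the
  presentation of the empty quandle. A set of relations \<open>R\<close> presents a quandle \<open>Q\<close> if
  \<open>presented_quandle R \<cong>\<^sub>Q Q\<close>.\<close>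

definition presented_quandle ::
    "('s quandle_word \<times> 's quandle_word) set \<Rightarrow> 's quandle_word set quandle"
  where "presented_quandle R =
    \<lparr>carrier = UNIV // {(u, v). quandle_cong R u v},
     act = (\<lambda>U V. {w. \<exists>u\<in>U. \<exists>v\<in>V. quandle_cong R (Act u v) w})\<rparr>"

abbreviation word_class ::
    "('s quandle_word \<times> 's quandle_word) set \<Rightarrow> 's quandle_word \<Rightarrow> 's quandle_word set"
  where "word_class R u \<equiv> {w. quandle_cong R u w}"

lemma carrier_presented_quandle: "carrier (presented_quandle R) = range (word_class R)"
  by (auto simp: presented_quandle_def quotient_def)

lemma word_class_eq_iff: "word_class R u = word_class R v \<longleftrightarrow> quandle_cong R u v"
  by (blast intro: quandle_cong.refl quandle_cong.sym quandle_cong.trans)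

lemma act_word_class:
  "word_class R u \<rhd>\<^bsub>presented_quandle R\<^esub> word_class R v = word_class R (Act u v)"
proof -
  have "quandle_cong R (Act u v) w"
    if "quandle_cong R u u'" "quandle_cong R v v'" "quandle_cong R (Act u' v') w" for u' v' w
    using that by (blast intro: quandle_cong.trans[OF quandle_cong.act])
  then show ?thesis
    by (auto simp: presented_quandle_def intro: quandle_cong.refl)
qed

lemma quandle_presented_quandle: "quandle (presented_quandle R)"
proof
  fix U assume "U \<in> carrier (presented_quandle R)"
  then obtain u where U: "U = word_class R u" by (auto simp: carrier_presented_quandle)
  show "U \<rhd>\<^bsub>presented_quandle R\<^esub> U = U"
    by (simp add: U act_word_class word_class_eq_iff quandle_cong.idem)
  show "bij_betw (\<lambda>V. U \<rhd>\<^bsub>presented_quandle R\<^esub> V)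
      (carrier (presented_quandle R)) (carrier (presented_quandle R))"
  proof (rule bij_betw_imageI)
    show "inj_on (\<lambda>V. U \<rhd>\<^bsub>presented_quandle R\<^esub> V) (carrier (presented_quandle R))"
    proof (rule inj_onI)
      fix V W
      assume "V \<in> carrier (presented_quandle R)" "W \<in> carrier (presented_quandle R)"
        and eq: "U \<rhd>\<^bsub>presented_quandle R\<^esub> V = U \<rhd>\<^bsub>presented_quandle R\<^esub> W"
      then obtain v w where V: "V = word_class R v" and W: "W = word_class R w"
        by (auto simp: carrier_presented_quandle)
      have "quandle_cong R (Act u v) (Act u w)"
        using eq by (simp only: U V W act_word_class word_class_eq_iff)
      then have "quandle_cong R (Inv_Act u (Act u v)) (Inv_Act u (Act u w))"
        by (intro quandle_cong.inv_act quandle_cong.refl)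
      then have "quandle_cong R v w"
        by (meson quandle_cong.inv_of_act quandle_cong.sym quandle_cong.trans)
      then show "V = W" by (simp only: V W word_class_eq_iff)
    qed
    have "V \<in> (\<lambda>V. U \<rhd>\<^bsub>presented_quandle R\<^esub> V) ` carrier (presented_quandle R)"
      if mem: "V \<in> carrier (presented_quandle R)" for V
    proof -
      obtain v where V: "V = word_class R v"
        using mem by (auto simp: carrier_presented_quandle)
      have "V = U \<rhd>\<^bsub>presented_quandle R\<^esub> word_class R (Inv_Act u v)"
        by (simp only: U V act_word_class word_class_eq_iff)
          (rule quandle_cong.sym[OF quandle_cong.act_inv])
      then show ?thesis by (auto simp: carrier_presented_quandle)
    qed
    then show "(\<lambda>V. U \<rhd>\<^bsub>presented_quandle R\<^esub> V) ` carrier (presented_quandle R) =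
        carrier (presented_quandle R)"
      by (auto simp: U carrier_presented_quandle act_word_class)
  qed
next
  fix U V W
  assume "U \<in> carrier (presented_quandle R)" "V \<in> carrier (presented_quandle R)"
    "W \<in> carrier (presented_quandle R)"
  then obtain u v w
    where U: "U = word_class R u" and V: "V = word_class R v" and W: "W = word_class R w"
    by (auto simp: carrier_presented_quandle)
  show "U \<rhd>\<^bsub>presented_quandle R\<^esub> (V \<rhd>\<^bsub>presented_quandle R\<^esub> W) =
      (U \<rhd>\<^bsub>presented_quandle R\<^esub> V) \<rhd>\<^bsub>presented_quandle R\<^esub> (U \<rhd>\<^bsub>presented_quandle R\<^esub> W)"
    by (simp only: U V W act_word_class word_class_eq_iff quandle_cong.distrib)
qed

definition thompson_relations :: "(nat quandle_word \<times> nat quandle_word) set"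
  where "thompson_relations = {(Act (Gen j) (Gen k), Gen (k + 1)) | j k. j < k}"

definition thompson_quandle :: "nat quandle_word set quandle"
  where "thompson_quandle = presented_quandle thompson_relations"


lemma thompson_relations_present: "presented_quandle thompson_relations \<cong>\<^sub>Q thompson_quandle"
  unfolding quandle_isomorphic_def thompson_quandle_def
proof
  have "U \<rhd>\<^bsub>Q\<^esub> V \<in> carrier Q" if "quandle Q" "U \<in> carrier Q" "V \<in> carrier Q"
    for Q :: "'a quandle" and U V
    using quandle.bij_act[OF that(1,2)] that(3) by (rule bij_betwE[rule_format])
  then show "id \<in> quandle_hom (presented_quandle thompson_relations) (presented_quandle thompson_relations)"
    by (simp add: quandle_hom_def)
qed simp


section \<open>Modules\<close>

text \<open>The library's record of modules extends that of rings; the fields \<^const>\<open>monoid.mult\<close> and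
  \<^const>\<open>one\<close> play no role in a module and are left unspecified below.\<close>

definition submodule_generated ::
    "('r, 'k) ring_scheme \<Rightarrow> ('r, 'a, 'm) module_scheme \<Rightarrow> 'a set \<Rightarrow> 'a set"
  where "submodule_generated R M A = \<Inter>{N. submodule N R M \<and> A \<subseteq> N}"

definition quotient_module ::
    "('r, 'a, 'm) module_scheme \<Rightarrow> 'a set \<Rightarrow> ('r, 'a set) module"
  where "quotient_module M N =
    \<lparr>carrier = a_rcosets\<^bsub>M\<^esub> N, monoid.mult = undefined, one = undefined,
     zero = N, add = set_add M,
     module.smult = (\<lambda>c U. \<Union>x\<in>U. N +>\<^bsub>M\<^esub> (c \<odot>\<^bsub>M\<^esub> x))\<rparr>"

definition module_sum ::
    "('r, 'a, 'm) module_scheme \<Rightarrow> ('r, 'b, 'n) module_scheme \<Rightarrow> ('r, 'a \<times> 'b) module"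
    (infixr \<open>\<oplus>\<^sub>M\<close> 65)
  where "M \<oplus>\<^sub>M M' =
    \<lparr>carrier = carrier M \<times> carrier M', monoid.mult = undefined, one = undefined,
     zero = (\<zero>\<^bsub>M\<^esub>, \<zero>\<^bsub>M'\<^esub>),
     add = (\<lambda>(x, x') (y, y'). (x \<oplus>\<^bsub>M\<^esub> y, x' \<oplus>\<^bsub>M'\<^esub> y')),
     module.smult = (\<lambda>c (x, x'). (c \<odot>\<^bsub>M\<^esub> x, c \<odot>\<^bsub>M'\<^esub> x'))\<rparr>"

definition module_hom ::
    "('r, 'k) ring_scheme \<Rightarrow> ('r, 'a, 'm) module_scheme \<Rightarrow> ('r, 'b, 'n) module_scheme \<Rightarrow> ('a \<Rightarrow> 'b) set"
  where "module_hom R M M' = {h \<in> carrier M \<rightarrow> carrier M'.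
    (\<forall>x\<in>carrier M. \<forall>y\<in>carrier M. h (x \<oplus>\<^bsub>M\<^esub> y) = h x \<oplus>\<^bsub>M'\<^esub> h y) \<and>
    (\<forall>c\<in>carrier R. \<forall>x\<in>carrier M. h (c \<odot>\<^bsub>M\<^esub> x) = c \<odot>\<^bsub>M'\<^esub> h x)}"

definition module_isomorphic ::
    "('r, 'k) ring_scheme \<Rightarrow> ('r, 'a, 'm) module_scheme \<Rightarrow> ('r, 'b, 'n) module_scheme \<Rightarrow> bool"
  where "module_isomorphic R M M' \<longleftrightarrow>
    (\<exists>h\<in>module_hom R M M'. bij_betw h (carrier M) (carrier M'))"


section \<open>Laurent polynomials and the Alexander module\<close>

text \<open>An integral Laurent polynomial is a finitely supported map from exponents to
  coefficients; the product on \<^typ>\<open>int \<Rightarrow>\<^sub>0 int\<close> is the convolution product.\<close>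

type_synonym laurent = "int \<Rightarrow>\<^sub>0 int"

abbreviation laurent_ring :: "laurent ring"
  where "laurent_ring \<equiv> ring_of_type_algebra"

definition q :: laurent where "q = Poly_Mapping.single 1 1"

definition q_inv :: laurent where "q_inv = Poly_Mapping.single (- 1) 1"

lemma q_mult_q_inv: "q * q_inv = 1"
  by (simp add: q_def q_inv_def mult_single)

definition laurent_module :: "(laurent, laurent) module"
  where "laurent_module =
    \<lparr>carrier = UNIV, monoid.mult = undefined, one = undefined, zero = 0, add = (+), module.smult = (*)\<rparr>"

definition free_module :: "(laurent, 's \<Rightarrow>\<^sub>0 laurent) module"
  where "free_module =
    \<lparr>carrier = UNIV, monoid.mult = undefined, one = undefined, zero = 0, add = (+),
     module.smult = (\<lambda>c. Poly_Mapping.map (\<lambda>a. c * a))\<rparr>"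

text \<open>\<open>\<int>\<close> with \<open>q\<close> acting as the identity, so that a Laurent polynomial acts as
  the sum of its coefficients; see \<open>quotient_laurent_module_iso_int_module\<close> below.\<close>

definition augmentation :: "laurent \<Rightarrow> int"
  where "augmentation f = (\<Sum>k\<in>Poly_Mapping.keys f. Poly_Mapping.lookup f k)"

definition int_module :: "(laurent, int) module"
  where "int_module =
    \<lparr>carrier = UNIV, monoid.mult = undefined, one = undefined, zero = 0, add = (+),
     module.smult = (\<lambda>f n. augmentation f * n)\<rparr>"

text \<open>The case of \<open>Inv_Act\<close> is forced by that of \<open>Act\<close>: solving
  \<open>(1 - q) x + q z = y\<close> for \<open>z\<close> gives \<open>z = (1 - q\<^sup>-\<^sup>1) x + q\<^sup>-\<^sup>1 y\<close>.\<close>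

primrec alexander_word :: "'s quandle_word \<Rightarrow> ('s \<Rightarrow>\<^sub>0 laurent)" where
  "alexander_word (Gen s) = Poly_Mapping.single s 1"
| "alexander_word (Act u v) =
    (1 - q) \<odot>\<^bsub>free_module\<^esub> alexander_word u + q \<odot>\<^bsub>free_module\<^esub> alexander_word v"
| "alexander_word (Inv_Act u v) =
    (1 - q_inv) \<odot>\<^bsub>free_module\<^esub> alexander_word u + q_inv \<odot>\<^bsub>free_module\<^esub> alexander_word v"

definition alexander_module ::
    "('s quandle_word \<times> 's quandle_word) set \<Rightarrow> (laurent, ('s \<Rightarrow>\<^sub>0 laurent) set) module"
  where "alexander_module R = quotient_module free_module
    (submodule_generated laurent_ring free_module {alexander_word u - alexander_word v | u v. (u, v) \<in> R})"


section \<open>The module structures\<close>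

lemma laurent_ring_simps [simp]:
  "carrier laurent_ring = UNIV" "zero laurent_ring = 0" "one laurent_ring = 1"
  "add laurent_ring = (+)" "monoid.mult laurent_ring = (*)"
  by (simp_all add: ring_of_type_algebra_def fun_eq_iff)

lemma laurent_type_moduleI:
  fixes M :: "(laurent, 'a::ab_group_add) module"
  assumes "carrier M = UNIV" "zero M = 0" "add M = (+)"
    and "\<And>a b x. module.smult M (a + b) x = module.smult M a x + module.smult M b x"
    and "\<And>a x y. module.smult M a (x + y) = module.smult M a x + module.smult M a y"
    and "\<And>a b x. module.smult M (a * b) x = module.smult M a (module.smult M b x)"
    and "\<And>x. module.smult M 1 x = x"
  shows "Module.module laurent_ring M"
proof (rule moduleI)
  show "cring laurent_ring" ..
  show "abelian_group M"
  proof (rule abelian_groupI)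
    fix x assume "x \<in> carrier M"
    show "\<exists>y\<in>carrier M. y \<oplus>\<^bsub>M\<^esub> x = \<zero>\<^bsub>M\<^esub>"
      by (rule bexI[of _ "- x"]) (simp_all add: assms)
  qed (simp_all add: assms algebra_simps)
qed (simp_all add: assms)

lemma module_laurent_module: "Module.module laurent_ring laurent_module"
  by (rule laurent_type_moduleI) (simp_all add: laurent_module_def algebra_simps)

lemma lookup_smult_free_module:
  "Poly_Mapping.lookup (c \<odot>\<^bsub>free_module\<^esub> x) s = c * Poly_Mapping.lookup x s"
  by (simp add: free_module_def Poly_Mapping.map.rep_eq when_def)

lemma module_free_module: "Module.module laurent_ring (free_module :: (laurent, 's \<Rightarrow>\<^sub>0 laurent) module)"
  by (rule laurent_type_moduleI)
    (auto intro!: poly_mapping_eqI simp: lookup_smult_free_module lookup_add algebra_simps,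
      simp_all add: free_module_def)

lemma augmentation_eq: "finite K \<Longrightarrow> Poly_Mapping.keys f \<subseteq> K
    \<Longrightarrow> augmentation f = (\<Sum>k\<in>K. Poly_Mapping.lookup f k)"
  unfolding augmentation_def by (rule sum.mono_neutral_left) (auto simp: in_keys_iff)

lemma augmentation_add: "augmentation (f + g) = augmentation f + augmentation g"
proof -
  let ?K = "Poly_Mapping.keys f \<union> Poly_Mapping.keys g"
  have "Poly_Mapping.keys (f + g) \<subseteq> ?K" by (rule Poly_Mapping.keys_add)
  then show ?thesis
    by (simp add: augmentation_eq[of ?K] lookup_add sum.distrib)
qed

lemma augmentation_single [simp]: "augmentation (Poly_Mapping.single k a) = a"
  by (simp add: augmentation_def)

lemma laurent_induct [case_names single add]:
  fixes f :: laurent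
  assumes "\<And>k a. P (Poly_Mapping.single k a)" "\<And>f g. P f \<Longrightarrow> P g \<Longrightarrow> P (f + g)"
  shows "P f"
proof (induction f rule: update_induct)
  case const
  show ?case using assms(1)[of 0 0] by simp
next
  case (update f k a)
  have "Poly_Mapping.update k a f = f + Poly_Mapping.single k a"
    using update.hyps(1)
    by (intro poly_mapping_eqI) (auto simp: lookup_update lookup_add lookup_single in_keys_iff)
  then show ?case using assms update.IH by simp
qed

lemma augmentation_mult: "augmentation (f * g) = augmentation f * augmentation g"
proof (induction f rule: laurent_induct)
  case (single k a)
  show ?case
    by (induction g rule: laurent_induct) (simp_all add: mult_single algebra_simps augmentation_add)
qed (simp add: algebra_simps augmentation_add)

lemma augmentation_1 [simp]: "augmentation 1 = 1"
  using augmentation_single[of 0 1] by (simp del: augmentation_single)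

lemma augmentation_diff: "augmentation (f - g) = augmentation f - augmentation g"
  using augmentation_add[of "f - g" g] by simp

lemma augmentation_0 [simp]: "augmentation 0 = 0"
  using augmentation_add[of 0 0] by simp

lemma augmentation_minus: "augmentation (- f) = - augmentation f"
  using augmentation_diff[of 0 f] by simp

lemma module_int_module: "Module.module laurent_ring int_module"
  by (rule laurent_type_moduleI)
    (simp_all add: int_module_def augmentation_add augmentation_mult algebra_simps)

lemma q_acts_trivially: "q \<odot>\<^bsub>int_module\<^esub> n = n"
  by (simp add: int_module_def q_def)

lemma submodule_generated_one_minus_q:
  "submodule_generated laurent_ring laurent_module {1 - q} = {f. augmentation f = 0}"
proof (rule equalityI)
  interpret Module.module laurent_ring laurent_module by (rule module_laurent_module)
  have minus: "\<ominus>\<^bsub>laurent_module\<^esub> f = - f" for f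
    by (rule M.minus_equality) (simp_all add: laurent_module_def)
  have "submodule {f. augmentation f = 0} laurent_ring laurent_module"
    by (rule submoduleI)
      (auto simp: minus augmentation_minus,
       auto simp: laurent_module_def augmentation_add augmentation_mult)
  moreover have "augmentation (1 - q) = 0" by (simp add: augmentation_diff q_def)
  ultimately show "submodule_generated laurent_ring laurent_module {1 - q} \<subseteq> {f. augmentation f = 0}"
    by (auto simp: submodule_generated_def)
  show "{f. augmentation f = 0} \<subseteq> submodule_generated laurent_ring laurent_module {1 - q}"
    unfolding submodule_generated_def
  proof clarsimp
    fix f N
    assume f: "augmentation f = 0" and sub: "submodule N laurent_ring laurent_module"
      and mem: "1 - q \<in> N"
    have zero: "0 \<in> N" and add: "\<And>x y. x \<in> N \<Longrightarrow> y \<in> N \<Longrightarrow> x + y \<in> N"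
      and neg: "\<And>x. x \<in> N \<Longrightarrow> - x \<in> N" and smult: "\<And>c x. x \<in> N \<Longrightarrow> c * x \<in> N"
      using submoduleE[OF sub] subgroup.one_closed[OF submodule.axioms(1)[OF sub]]
      by (simp_all add: minus, simp_all add: laurent_module_def)
    have step: "Poly_Mapping.single k a - Poly_Mapping.single (k + 1) a \<in> N" for k a
      using smult[OF mem, of "Poly_Mapping.single k a"]
      by (simp add: q_def algebra_simps mult_single)
    have "Poly_Mapping.single 0 a - Poly_Mapping.single k a \<in> N" for k a
    proof (induction k rule: int_induct[of _ 0])
      case (step1 i) then show ?case using add[OF step1.IH step[of i a]] by simp
    next
      case (step2 i) then show ?case
        using add[OF step2.IH neg[OF step[of "i - 1" a]]] by simp
    qed (simp add: zero)
    then have "Poly_Mapping.single 0 (augmentation g) - g \<in> N" for g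
    proof (induction g rule: laurent_induct)
      case (add g h)
      then show ?case using \<open>\<And>x y. x \<in> N \<Longrightarrow> y \<in> N \<Longrightarrow> x + y \<in> N\<close>[OF add.IH]
        by (simp add: augmentation_add single_add algebra_simps)
    qed simp
    from this[of f] have "- f \<in> N" by (simp add: f)
    from neg[OF this] show "f \<in> N" by simp
  qed
qed

lemma quotient_laurent_module_iso_int_module:
  "module_isomorphic laurent_ring
    (quotient_module laurent_module (submodule_generated laurent_ring laurent_module {1 - q}))
    int_module"
proof -
  let ?Q = "quotient_module laurent_module {f. augmentation f = 0}"
  let ?C = "\<lambda>n. {f. augmentation f = n}"
  have surj: "\<exists>f. augmentation f = n" for n
    by (rule exI[of _ "Poly_Mapping.single 0 n"]) simp
  have split: "f \<in> ?C (m + n) \<longleftrightarrow> (\<exists>h\<in>?C m. \<exists>k\<in>?C n. f = h + k)" for f m n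
  proof
    assume f: "f \<in> ?C (m + n)"
    obtain g where "augmentation g = m" using surj by blast
    with f have "g \<in> ?C m" "f - g \<in> ?C n" "f = g + (f - g)"
      by (simp_all add: augmentation_diff)
    then show "\<exists>h\<in>?C m. \<exists>k\<in>?C n. f = h + k" by blast
  qed (auto simp: augmentation_add)
  have coset: "?C 0 +>\<^bsub>laurent_module\<^esub> g = ?C (augmentation g)" for g
  proof -
    have "f \<in> ?C (augmentation g) \<longleftrightarrow> (\<exists>h\<in>?C 0. f = h + g)" for f
    proof
      assume "f \<in> ?C (augmentation g)"
      then have "f - g \<in> ?C 0" "f = (f - g) + g" by (simp_all add: augmentation_diff)
      then show "\<exists>h\<in>?C 0. f = h + g" by blast
    qed (auto simp: augmentation_add)
    then show ?thesis
      by (simp add: a_r_coset_def r_coset_def laurent_module_def) blast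
  qed
  have carr: "carrier ?Q = range ?C"
  proof -
    have "carrier laurent_module = UNIV" by (simp add: laurent_module_def)
    then have "carrier ?Q = range (\<lambda>g. ?C (augmentation g))"
      by (auto simp: quotient_module_def A_RCOSETS_def' coset)
    also have "\<dots> = ?C ` range augmentation" by (simp add: image_image)
    also have "range augmentation = UNIV" using surj by (metis surj_def)
    finally show ?thesis .
  qed
  have add: "?C m \<oplus>\<^bsub>?Q\<^esub> ?C n = ?C (m + n)" for m n
  proof (rule Set.set_eqI)
    fix f
    have "f \<in> ?C m \<oplus>\<^bsub>?Q\<^esub> ?C n \<longleftrightarrow> (\<exists>h\<in>?C m. \<exists>k\<in>?C n. f = h + k)"
      by (simp add: quotient_module_def set_add_def set_mult_def laurent_module_def)
    then show "f \<in> ?C m \<oplus>\<^bsub>?Q\<^esub> ?C n \<longleftrightarrow> f \<in> ?C (m + n)"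
      by (simp only: split)
  qed
  have smult: "c \<odot>\<^bsub>?Q\<^esub> ?C n = ?C (augmentation c * n)" for c n
  proof -
    have "c \<odot>\<^bsub>?Q\<^esub> ?C n = (\<Union>f\<in>?C n. ?C (augmentation (c * f)))"
      by (simp add: quotient_module_def coset) (simp add: laurent_module_def)
    also have "\<dots> = ?C (augmentation c * n)"
      using surj[of n] by (fastforce simp: augmentation_mult)
    finally show ?thesis .
  qed
  define h where "h U = the_elem (augmentation ` U)" for U
  have h: "h (?C n) = n" for n
  proof -
    have "augmentation ` ?C n = {n}" using surj[of n] by auto
    then show ?thesis by (simp add: h_def)
  qed
  have "h \<in> module_hom laurent_ring ?Q int_module"
    by (auto simp: module_hom_def carr add smult h) (simp_all add: int_module_def)
  moreover have "bij_betw h (carrier ?Q) (carrier int_module)"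
    by (rule bij_betwI[where g = ?C]) (auto simp: carr h, simp_all add: int_module_def)
  ultimately show ?thesis
    unfolding submodule_generated_one_minus_q module_isomorphic_def by blast
qed

end

theory Submission
  imports Defs "HOL-Library.Product_Plus"
begin

text \<open>
  In the Alexander module of the defining presentation of \<open>P\<close>, write \<open>p\<^sub>k\<close> for the generators. Two
  generators \<open>p\<^sub>i\<close>, \<open>p\<^sub>j\<close> act in the same way on every \<open>p\<^sub>k\<close> with \<open>k\<close> large, so
  \<open>(1 - q) (p\<^sub>i - p\<^sub>j) = 0\<close>. The relation \<open>(1 - q) p\<^sub>j + q p\<^sub>k = p\<^bsub>k + 1\<^esub>\<close> for \<open>j < k\<close> then becomes
  \<open>p\<^bsub>k + 1\<^esub> = p\<^sub>k\<close>, which leaves the two generators \<open>p\<^sub>0\<close> and \<open>p\<^sub>1 - p\<^sub>0\<close>, the second one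
  annihilated by \<open>1 - q\<close>. Conversely, sending \<open>p\<^sub>0\<close> to \<open>(1, 0)\<close> and every other generator to
  \<open>(1, 1)\<close> respects all relations. This linear map is therefore onto
  \<open>\<int>[q\<^sup>\<plusminus>\<^sup>1] \<oplus> \<int>\<close>, with the relators as its kernel (\<open>thompson_linear_map\<close>).

  For an arbitrary presentation of \<open>P\<close>, an isomorphism of presented quandles is lifted to maps
  \<open>f\<close>, \<open>g\<close> between words that are inverse to each other up to congruence. Congruent words have the
  same Alexander combination modulo relators (\<open>alexander_word_cong\<close>), so the linear maps that
  send a generator \<open>s\<close> to the combination of \<open>f s\<close>, respectively \<open>g s\<close>, preserve relators
  and are inverse to each other modulo relators. Composing with the first of them turns a
  surjection whose kernel is the relators of one presentation into such a surjection for the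
  other one (\<open>alexander_surjection_transfer\<close>). The first isomorphism theorem
  (\<open>quotient_free_module_isomorphic\<close>) concludes.
\<close>

section \<open>Linear algebra over Laurent polynomials\<close>

abbreviation scale :: "laurent \<Rightarrow> ('s \<Rightarrow>\<^sub>0 laurent) \<Rightarrow> ('s \<Rightarrow>\<^sub>0 laurent)" (infixr \<open>\<cdot>\<close> 75)
  where "scale \<equiv> module.smult free_module"

abbreviation basis :: "'s \<Rightarrow> ('s \<Rightarrow>\<^sub>0 laurent)"
  where "basis s \<equiv> Poly_Mapping.single s 1"

interpretation free: Modules.module scale
  by standard (auto intro!: poly_mapping_eqI simp: lookup_smult_free_module lookup_add algebra_simps)

lemma free_module_expansion:
  "x = (\<Sum>s\<in>Poly_Mapping.keys x. Poly_Mapping.lookup x s \<cdot> basis s)"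
  by (rule poly_mapping_eqI)
    (simp add: lookup_sum lookup_smult_free_module lookup_single when_def in_keys_iff if_distrib
      cong: if_cong)

lemma free_module_induct [case_names basis add scale]:
  assumes basis: "\<And>s. P (basis s)"
    and add: "\<And>x y. P x \<Longrightarrow> P y \<Longrightarrow> P (x + y)"
    and scale: "\<And>c x. P x \<Longrightarrow> P (c \<cdot> x)"
  shows "P x"
proof -
  have "P 0"
    using scale[OF basis, of 0] by simp
  then have "free.subspace {x. P x}"
    by (auto intro: free.subspaceI add scale)
  then have "(\<Sum>s\<in>Poly_Mapping.keys x. Poly_Mapping.lookup x s \<cdot> basis s) \<in> {x. P x}"
    by (intro free.subspace_sum) (simp_all add: scale basis)
  then show ?thesis
    by (simp flip: free_module_expansion)
qed

lemma linear_extension_exists: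
  fixes m :: "'s \<Rightarrow> 'b::ab_group_add"
  assumes "Modules.module sm"
  obtains F where "Modules.module_hom scale sm F" "\<And>s. F (basis s) = m s"
proof
  interpret tgt: Modules.module sm by fact
  let ?F = "\<lambda>x. \<Sum>s\<in>Poly_Mapping.keys x. sm (Poly_Mapping.lookup x s) (m s)"
  have F: "?F x = (\<Sum>s\<in>K. sm (Poly_Mapping.lookup x s) (m s))"
    if "finite K" "Poly_Mapping.keys x \<subseteq> K" for x K
    using that by (intro sum.mono_neutral_left) (auto simp: in_keys_iff)
  show "Modules.module_hom scale sm ?F"
  proof
    fix x y :: "'s \<Rightarrow>\<^sub>0 laurent" and c
    let ?K = "Poly_Mapping.keys x \<union> Poly_Mapping.keys y"
    have "?F (x + y) = (\<Sum>s\<in>?K. sm (Poly_Mapping.lookup (x + y) s) (m s))"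
      by (rule F) (simp_all add: Poly_Mapping.keys_add)
    also have "\<dots> = (\<Sum>s\<in>?K. sm (Poly_Mapping.lookup x s) (m s))
        + (\<Sum>s\<in>?K. sm (Poly_Mapping.lookup y s) (m s))"
      by (simp add: lookup_add tgt.scale_left_distrib sum.distrib)
    also have "\<dots> = ?F x + ?F y"
      by (simp add: F[of ?K x] F[of ?K y])
    finally show "?F (x + y) = ?F x + ?F y" .
    have "?F (c \<cdot> x) = (\<Sum>s\<in>Poly_Mapping.keys x. sm (Poly_Mapping.lookup (c \<cdot> x) s) (m s))"
      by (rule F) (auto simp: in_keys_iff lookup_smult_free_module)
    then show "?F (c \<cdot> x) = sm c (?F x)"
      by (simp add: lookup_smult_free_module tgt.scale_sum_right)
  qed
  show "?F (basis s) = m s" for s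
    by simp
qed

lemma submodule_iff_subspace:
  "submodule N laurent_ring free_module \<longleftrightarrow> free.subspace N"
proof
  interpret Module.module laurent_ring free_module by (rule module_free_module)
  have minus: "\<ominus>\<^bsub>free_module\<^esub> x = - x" for x :: "'a \<Rightarrow>\<^sub>0 laurent"
    by (rule M.minus_equality) (simp_all add: free_module_def)
  show "free.subspace N" if sub: "submodule N laurent_ring free_module"
  proof (rule free.subspaceI)
    show "0 \<in> N"
      using subgroup.one_closed[OF submodule.axioms(1)[OF sub]] by (simp add: free_module_def)
    show "x + y \<in> N" if "x \<in> N" "y \<in> N" for x y
      using submoduleE(5)[OF sub that] by (simp add: free_module_def)
    show "c \<cdot> x \<in> N" if "x \<in> N" for c x
      using submoduleE(4)[OF sub _ that] by simp
  qed
  show "submodule N laurent_ring free_module" if sub: "free.subspace N"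
  proof (rule submoduleI)
    show "\<ominus>\<^bsub>free_module\<^esub> x \<in> N" if "x \<in> N" for x
      using free.subspace_neg[OF sub that] by (simp add: minus)
    show "x \<oplus>\<^bsub>free_module\<^esub> y \<in> N" if "x \<in> N" "y \<in> N" for x y
      using free.subspace_add[OF sub that] by (simp add: free_module_def)
    show "c \<cdot> x \<in> N" if "x \<in> N" for c x
      using free.subspace_scale[OF sub that] .
  qed (use free.subspace_0[OF sub] in \<open>simp_all add: free_module_def\<close>)
qed

lemma submodule_generated_eq_span:
  "submodule_generated laurent_ring free_module A = free.span A"
  by (simp add: submodule_generated_def submodule_iff_subspace free.span_def hull_def)

text \<open>The first isomorphism theorem: the cosets of the kernel are the fibres of \<open>F\<close>, and the
  isomorphism sends a fibre to the value of \<open>F\<close> on it.\<close>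

lemma quotient_free_module_isomorphic:
  fixes M :: "(laurent, 'b::ab_group_add) module" and F :: "('s \<Rightarrow>\<^sub>0 laurent) \<Rightarrow> 'b"
  assumes M: "carrier M = UNIV" "add M = (+)"
    and F: "Modules.module_hom scale (module.smult M) F" "surj F"
  shows "module_isomorphic laurent_ring (quotient_module free_module {x. F x = 0}) M"
proof -
  interpret F: Modules.module_hom scale "module.smult M" F by fact
  let ?Q = "quotient_module free_module {x. F x = 0}"
  let ?C = "\<lambda>b. {x. F x = b}"
  have surj: "\<exists>x. F x = b" for b
    using \<open>surj F\<close> by (metis surjD)
  have split: "x \<in> ?C (a + b) \<longleftrightarrow> (\<exists>y\<in>?C a. \<exists>z\<in>?C b. x = y + z)" for x a b
  proof
    assume x: "x \<in> ?C (a + b)"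
    obtain y where "F y = a" using surj by blast
    with x have "y \<in> ?C a" "x - y \<in> ?C b" "x = y + (x - y)"
      by (simp_all add: F.diff)
    then show "\<exists>y\<in>?C a. \<exists>z\<in>?C b. x = y + z" by blast
  qed (auto simp: F.add)
  have coset: "?C 0 +>\<^bsub>free_module\<^esub> y = ?C (F y)" for y
  proof -
    have "x \<in> ?C (F y) \<longleftrightarrow> (\<exists>z\<in>?C 0. x = z + y)" for x
    proof
      assume "x \<in> ?C (F y)"
      then have "x - y \<in> ?C 0" "x = (x - y) + y" by (simp_all add: F.diff)
      then show "\<exists>z\<in>?C 0. x = z + y" by blast
    qed (auto simp: F.add)
    then show ?thesis
      by (simp add: a_r_coset_def r_coset_def free_module_def) blast
  qed
  have carr: "carrier ?Q = range ?C"
  proof -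
    have "carrier free_module = (UNIV :: ('s \<Rightarrow>\<^sub>0 laurent) set)" by (simp add: free_module_def)
    then have "carrier ?Q = range (\<lambda>y. ?C (F y))"
      by (auto simp: quotient_module_def A_RCOSETS_def' coset)
    also have "\<dots> = ?C ` range F" by (simp add: image_image)
    finally show ?thesis by (simp add: \<open>surj F\<close>)
  qed
  have add: "?C a \<oplus>\<^bsub>?Q\<^esub> ?C b = ?C (a + b)" for a b
  proof (rule Set.set_eqI)
    fix x
    have "x \<in> ?C a \<oplus>\<^bsub>?Q\<^esub> ?C b \<longleftrightarrow> (\<exists>y\<in>?C a. \<exists>z\<in>?C b. x = y + z)"
      by (simp add: quotient_module_def set_add_def set_mult_def free_module_def)
    then show "x \<in> ?C a \<oplus>\<^bsub>?Q\<^esub> ?C b \<longleftrightarrow> x \<in> ?C (a + b)"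
      by (simp only: split)
  qed
  have smult: "c \<odot>\<^bsub>?Q\<^esub> ?C b = ?C (c \<odot>\<^bsub>M\<^esub> b)" for c b
  proof -
    have "c \<odot>\<^bsub>?Q\<^esub> ?C b = (\<Union>x\<in>?C b. ?C (F (c \<cdot> x)))"
      by (simp add: quotient_module_def coset)
    also have "\<dots> = ?C (c \<odot>\<^bsub>M\<^esub> b)"
      using surj[of b] by (auto simp: F.scale)
    finally show ?thesis .
  qed
  define h where "h U = the_elem (F ` U)" for U
  have h: "h (?C b) = b" for b
  proof -
    have "F ` ?C b = {b}" using surj[of b] by auto
    then show ?thesis by (simp add: h_def)
  qed
  have "h \<in> module_hom laurent_ring ?Q M"
    by (auto simp: module_hom_def carr add smult h M)
  moreover have "bij_betw h (carrier ?Q) (carrier M)"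
    by (rule bij_betwI[where g = ?C]) (auto simp: carr h M)
  ultimately show ?thesis
    unfolding module_isomorphic_def by blast
qed


section \<open>Invariance of the Alexander module\<close>

definition alexander_relators :: "('s quandle_word \<times> 's quandle_word) set \<Rightarrow> ('s \<Rightarrow>\<^sub>0 laurent) set"
  where "alexander_relators R = free.span {alexander_word u - alexander_word v | u v. (u, v) \<in> R}"

lemma alexander_module_eq:
  "alexander_module R = quotient_module free_module (alexander_relators R)"
  by (simp add: alexander_module_def alexander_relators_def submodule_generated_eq_span)

lemma subspace_alexander_relators: "free.subspace (alexander_relators R)"
  by (simp add: alexander_relators_def)

lemmas relators_zero = free.subspace_0[OF subspace_alexander_relators]
  and relators_add = free.subspace_add[OF subspace_alexander_relators]
  and relators_diff = free.subspace_diff[OF subspace_alexander_relators]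
  and relators_scale = free.subspace_scale[OF subspace_alexander_relators]

lemma relators_trans:
  assumes "x - y \<in> alexander_relators R" "y - z \<in> alexander_relators R"
  shows "x - z \<in> alexander_relators R"
  using relators_add[OF assms] by simp

lemma relators_combination:
  assumes "x - x' \<in> alexander_relators R" "y - y' \<in> alexander_relators R"
  shows "(a \<cdot> x + b \<cdot> y) - (a \<cdot> x' + b \<cdot> y') \<in> alexander_relators R"
  using relators_add[OF relators_scale[OF assms(1), of a] relators_scale[OF assms(2), of b]]
  by (simp add: free.scale_right_diff_distrib algebra_simps)

lemma q_mult_q_inv_cancel: "q * (q_inv * a) = a" "q_inv * (q * a) = a"
  by (simp_all add: q_mult_q_inv mult.commute[of q_inv q] flip: mult.assoc)

text \<open>The operation \<open>x \<rhd> y = (1 - q) x + q y\<close> makes every \<open>\<int>[q\<^sup>\<plusminus>\<^sup>1]\<close>-module a quandle.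
  So the quandle axioms hold identically, and only the relations of \<open>R\<close> contribute.\<close>

lemma alexander_word_cong:
  assumes "quandle_cong R u v"
  shows "alexander_word u - alexander_word v \<in> alexander_relators R"
  using assms
proof induction
  case (rel u v)
  then show ?case
    unfolding alexander_relators_def by (intro free.span_base) blast
next
  case (sym u v)
  then show ?case
    using free.subspace_neg[OF subspace_alexander_relators] by fastforce
next
  case (trans u v w)
  then show ?case by (blast intro: relators_trans)
next
  case (act_inv u v)
  have "alexander_word (Act u (Inv_Act u v)) = alexander_word v"
    by (rule poly_mapping_eqI)
      (simp add: lookup_smult_free_module lookup_add, simp add: algebra_simps q_mult_q_inv_cancel)
  then show ?case by (simp only: diff_self relators_zero)
next
  case (inv_of_act u v)
  have "alexander_word (Inv_Act u (Act u v)) = alexander_word v"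
    by (rule poly_mapping_eqI)
      (simp add: lookup_smult_free_module lookup_add, simp add: algebra_simps q_mult_q_inv_cancel)
  then show ?case by (simp only: diff_self relators_zero)
next
  case (distrib u v w)
  have "alexander_word (Act u (Act v w)) = alexander_word (Act (Act u v) (Act u w))"
    by (rule poly_mapping_eqI)
      (simp add: lookup_smult_free_module lookup_add, simp add: algebra_simps)
  then show ?case by (simp only: diff_self relators_zero)
next
  case (idem u)
  have "alexander_word (Act u u) = alexander_word u"
    by (rule poly_mapping_eqI)
      (simp add: lookup_smult_free_module lookup_add, simp add: algebra_simps)
  then show ?case by (simp only: diff_self relators_zero)
qed (simp_all add: relators_zero relators_combination)

text \<open>Maps between words that induce a quandle homomorphism between the presented quandles. They
  are only required to be compatible with the operation up to congruence, because they arise by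
  choosing representatives.\<close>

definition word_hom ::
    "('s quandle_word \<times> 's quandle_word) set \<Rightarrow> ('t quandle_word \<times> 't quandle_word) set
      \<Rightarrow> ('s quandle_word \<Rightarrow> 't quandle_word) \<Rightarrow> bool"
  where "word_hom R R' f \<longleftrightarrow>
    (\<forall>u v. quandle_cong R u v \<longrightarrow> quandle_cong R' (f u) (f v)) \<and>
    (\<forall>u v. quandle_cong R' (f (Act u v)) (Act (f u) (f v)))"

text \<open>\<open>Inv_Act u v\<close> is determined up to congruence as the solution \<open>w\<close> of \<open>u \<rhd> w = v\<close>, so a map
  that is compatible with the operation is compatible with its inverse.\<close>

lemma word_hom_Inv_Act:
  assumes "word_hom R R' f"
  shows "quandle_cong R' (f (Inv_Act u v)) (Inv_Act (f u) (f v))"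
proof -
  let ?w = "Inv_Act u v"
  have "quandle_cong R' (f (Act u ?w)) (f v)"
    using assms quandle_cong.act_inv by (fastforce simp: word_hom_def)
  then have "quandle_cong R' (Act (f u) (f ?w)) (f v)"
    using assms by (meson word_hom_def quandle_cong.sym quandle_cong.trans)
  then have "quandle_cong R' (Inv_Act (f u) (Act (f u) (f ?w))) (Inv_Act (f u) (f v))"
    by (intro quandle_cong.inv_act quandle_cong.refl)
  then show ?thesis
    by (meson quandle_cong.inv_of_act quandle_cong.sym quandle_cong.trans)
qed

text \<open>The maps \<open>f\<close> and \<open>g\<close> pick representatives of the images under the isomorphism and under
  its inverse. That \<open>g\<close> is a homomorphism follows by applying \<open>f\<close>, which reflects
  congruence.\<close>

lemma isomorphic_presented_quandles_word_homs:
  assumes "presented_quandle R \<cong>\<^sub>Q presented_quandle R'"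
  obtains f g where "word_hom R R' f" "word_hom R' R g"
    "\<And>u. quandle_cong R (g (f u)) u" "\<And>v. quandle_cong R' (f (g v)) v"
proof -
  obtain h where h: "h \<in> quandle_hom (presented_quandle R) (presented_quandle R')"
    and bij: "bij_betw h (range (word_class R)) (range (word_class R'))"
    using assms by (auto simp: quandle_isomorphic_def carrier_presented_quandle)
  have "\<exists>v. h (word_class R u) = word_class R' v" for u
    using bij_betwE[OF bij] by blast
  then obtain f where f: "\<And>u. h (word_class R u) = word_class R' (f u)"
    by metis
  have "\<exists>u. h (word_class R u) = word_class R' v" for v
  proof -
    have "word_class R' v \<in> h ` range (word_class R)"
      unfolding bij_betw_imp_surj_on[OF bij] by (rule rangeI)
    then show ?thesis by blast
  qed
  then obtain g where g: "\<And>v. word_class R' (f (g v)) = word_class R' v"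
    unfolding f by metis
  have cong: "quandle_cong R' (f u) (f v) \<longleftrightarrow> quandle_cong R u v" for u v
    using inj_on_eq_iff[OF bij_betw_imp_inj_on[OF bij], of "word_class R u" "word_class R v"]
    unfolding f word_class_eq_iff by simp
  have fg: "quandle_cong R' (f (g v)) v" for v
    using g by (simp only: word_class_eq_iff)
  have act: "quandle_cong R' (f (Act u v)) (Act (f u) (f v))" for u v
  proof -
    have "word_class R' (f (Act u v)) =
        h (word_class R u \<rhd>\<^bsub>presented_quandle R\<^esub> word_class R v)"
      by (simp only: act_word_class f)
    also have "\<dots> = h (word_class R u) \<rhd>\<^bsub>presented_quandle R'\<^esub> h (word_class R v)"
      using h by (simp add: quandle_hom_def carrier_presented_quandle)
    also have "\<dots> = word_class R' (Act (f u) (f v))"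
      by (simp only: act_word_class f)
    finally show ?thesis by (simp only: word_class_eq_iff)
  qed
  show thesis
  proof
    show "word_hom R R' f"
      by (simp add: word_hom_def cong act)
    show "quandle_cong R (g (f u)) u" for u
      using fg[of "f u"] by (simp only: cong)
    show "quandle_cong R' (f (g v)) v" for v
      by (rule fg)
    have "quandle_cong R' (f (g u)) (f (g v))" if "quandle_cong R' u v" for u v
      using that fg by (meson quandle_cong.sym quandle_cong.trans)
    moreover have "quandle_cong R' (f (g (Act u v))) (f (Act (g u) (g v)))" for u v
      using fg act quandle_cong.act[OF fg fg]
      by (meson quandle_cong.sym quandle_cong.trans)
    ultimately show "word_hom R' R g"
      by (simp add: word_hom_def cong)
  qed
qed

text \<open>A linear map that is prescribed by \<open>f\<close> on generators follows \<open>f\<close> on all words, because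
  both sides turn the operation into \<open>(1 - q) x + q y\<close>.\<close>

lemma alexander_word_hom:
  assumes \<Phi>: "Modules.module_hom scale scale \<Phi>" "\<And>s. \<Phi> (basis s) = alexander_word (f (Gen s))"
    and f: "word_hom R R' f"
  shows "\<Phi> (alexander_word u) - alexander_word (f u) \<in> alexander_relators R'"
proof -
  interpret \<Phi>: Modules.module_hom scale scale \<Phi> by fact
  show ?thesis
  proof (induction u)
    case (Gen s)
    show ?case by (simp add: \<Phi>(2) relators_zero)
  next
    case (Act u v)
    have "\<Phi> (alexander_word (Act u v)) - alexander_word (Act (f u) (f v)) \<in> alexander_relators R'"
      using relators_combination[OF Act] by (simp add: \<Phi>.add \<Phi>.scale)
    moreover have "quandle_cong R' (Act (f u) (f v)) (f (Act u v))"
      using f by (simp add: word_hom_def quandle_cong.sym)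
    ultimately show ?case
      by (blast intro: relators_trans alexander_word_cong)
  next
    case (Inv_Act u v)
    have "\<Phi> (alexander_word (Inv_Act u v)) - alexander_word (Inv_Act (f u) (f v))
        \<in> alexander_relators R'"
      using relators_combination[OF Inv_Act] by (simp add: \<Phi>.add \<Phi>.scale)
    moreover have "quandle_cong R' (Inv_Act (f u) (f v)) (f (Inv_Act u v))"
      using word_hom_Inv_Act[OF f] by (rule quandle_cong.sym)
    ultimately show ?case
      by (blast intro: relators_trans alexander_word_cong)
  qed
qed

lemma alexander_word_hom_relators:
  assumes \<Phi>: "Modules.module_hom scale scale \<Phi>" "\<And>s. \<Phi> (basis s) = alexander_word (f (Gen s))"
    and f: "word_hom R R' f" and x: "x \<in> alexander_relators R"
  shows "\<Phi> x \<in> alexander_relators R'"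
proof -
  interpret \<Phi>: Modules.module_hom scale scale \<Phi> by fact
  have "\<Phi> (alexander_word u - alexander_word v) \<in> alexander_relators R'" if "(u, v) \<in> R" for u v
  proof -
    have "alexander_word (f u) - alexander_word (f v) \<in> alexander_relators R'"
      using f quandle_cong.rel[OF that] by (simp add: word_hom_def alexander_word_cong)
    then have "\<Phi> (alexander_word u) - alexander_word (f v) \<in> alexander_relators R'"
      by (rule relators_trans[OF alexander_word_hom[OF \<Phi> f]])
    from relators_diff[OF this alexander_word_hom[OF \<Phi> f, of v]] show ?thesis
      by (simp add: \<Phi>.diff)
  qed
  then have "{alexander_word u - alexander_word v | u v. (u, v) \<in> R} \<subseteq> \<Phi> -` alexander_relators R'"
    by blast
  then have "alexander_relators R \<subseteq> \<Phi> -` alexander_relators R'"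
    unfolding alexander_relators_def[of R]
    by (rule free.span_minimal) (rule \<Phi>.subspace_vimage[OF subspace_alexander_relators])
  with x show ?thesis by blast
qed

lemma alexander_word_hom_inverse:
  assumes \<Phi>: "Modules.module_hom scale scale \<Phi>" "\<And>s. \<Phi> (basis s) = alexander_word (f (Gen s))"
    and \<Psi>: "Modules.module_hom scale scale \<Psi>" "\<And>s. \<Psi> (basis s) = alexander_word (g (Gen s))"
    and g: "word_hom R' R g" and gf: "\<And>u. quandle_cong R (g (f u)) u"
  shows "\<Psi> (\<Phi> x) - x \<in> alexander_relators R"
proof -
  interpret \<Phi>: Modules.module_hom scale scale \<Phi> by fact
  interpret \<Psi>: Modules.module_hom scale scale \<Psi> by fact
  show ?thesis
  proof (induction x rule: free_module_induct)
    case (basis s)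
    show ?case
      using relators_trans[OF alexander_word_hom[OF \<Psi> g] alexander_word_cong[OF gf, of "Gen s"]]
      by (simp add: \<Phi>(2))
  next
    case (add x y)
    then show ?case
      using relators_add[OF add] by (simp add: \<Phi>.add \<Psi>.add algebra_simps)
  next
    case (scale c x)
    then show ?case
      using relators_scale[OF scale, of c]
      by (simp add: \<Phi>.scale \<Psi>.scale free.scale_right_diff_distrib)
  qed
qed

text \<open>Expressing that an Alexander module is isomorphic to a given module by a surjection from
  the free module makes the transfer a composition of linear maps: quotients do not appear.\<close>

lemma alexander_surjection_transfer:
  fixes R :: "('s quandle_word \<times> 's quandle_word) set"
    and R' :: "('t quandle_word \<times> 't quandle_word) set"
  assumes iso: "presented_quandle R \<cong>\<^sub>Q presented_quandle R'"
    and F: "Modules.module_hom scale sm F" "surj F" "alexander_relators R' = {y. F y = 0}"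
  obtains G where "Modules.module_hom scale sm G" "surj G" "alexander_relators R = {x. G x = 0}"
proof -
  obtain f g where f: "word_hom R R' f" and g: "word_hom R' R g"
    and gf: "\<And>u. quandle_cong R (g (f u)) u" and fg: "\<And>v. quandle_cong R' (f (g v)) v"
    using isomorphic_presented_quandles_word_homs[OF iso] by metis
  obtain \<Phi> :: "('s \<Rightarrow>\<^sub>0 laurent) \<Rightarrow> ('t \<Rightarrow>\<^sub>0 laurent)"
    where \<Phi>: "Modules.module_hom scale scale \<Phi>" "\<And>s. \<Phi> (basis s) = alexander_word (f (Gen s))"
    by (rule linear_extension_exists[OF free.module_axioms, of "\<lambda>s. alexander_word (f (Gen s))"]) blast
  obtain \<Psi> :: "('t \<Rightarrow>\<^sub>0 laurent) \<Rightarrow> ('s \<Rightarrow>\<^sub>0 laurent)"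
    where \<Psi>: "Modules.module_hom scale scale \<Psi>" "\<And>s. \<Psi> (basis s) = alexander_word (g (Gen s))"
    by (rule linear_extension_exists[OF free.module_axioms, of "\<lambda>s. alexander_word (g (Gen s))"]) blast
  interpret F: Modules.module_hom scale sm F by fact
  show thesis
  proof
    show "Modules.module_hom scale sm (F \<circ> \<Phi>)"
      using \<Phi>(1) F(1) by (rule module_hom_compose)
    have "F (\<Phi> (\<Psi> y)) = F y" for y
      using alexander_word_hom_inverse[OF \<Psi> \<Phi> f fg, of y] by (simp add: F(3) F.diff)
    then show "surj (F \<circ> \<Phi>)"
      using \<open>surj F\<close> by (metis comp_apply surj_def)
    have "x \<in> alexander_relators R \<longleftrightarrow> \<Phi> x \<in> alexander_relators R'" for x
    proof
      assume "\<Phi> x \<in> alexander_relators R'"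
      then have "\<Psi> (\<Phi> x) \<in> alexander_relators R"
        by (rule alexander_word_hom_relators[OF \<Psi> g])
      from relators_diff[OF this alexander_word_hom_inverse[OF \<Phi> \<Psi> g gf, of x]]
      show "x \<in> alexander_relators R" by simp
    qed (rule alexander_word_hom_relators[OF \<Phi> f])
    then show "alexander_relators R = {x. (F \<circ> \<Phi>) x = 0}"
      by (auto simp: F(3))
  qed
qed


section \<open>Thompson's quandle\<close>

abbreviation thompson_target :: "(laurent, laurent \<times> int) module"
  where "thompson_target \<equiv> laurent_module \<oplus>\<^sub>M int_module"

lemma thompson_target_simps:
  "carrier thompson_target = UNIV" "add thompson_target = (+)"
  "c \<odot>\<^bsub>thompson_target\<^esub> (a, n) = (c * a, augmentation c * n)"
  by (auto simp: module_sum_def laurent_module_def int_module_def fun_eq_iff)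

interpretation target: Modules.module "module.smult thompson_target"
  by standard
    (auto simp: thompson_target_simps augmentation_add augmentation_mult algebra_simps)

lemma augmentation_q [simp]: "augmentation q = 1"
  by (simp add: q_def)

text \<open>All coefficients \<open>f\<close> that kill a given element modulo \<open>N\<close> form an ideal; if it
  contains \<open>1 - q\<close>, it contains the augmentation ideal.\<close>

lemma scale_mem_of_one_minus_q:
  assumes N: "free.subspace N" and x: "(1 - q) \<cdot> x \<in> N" and f: "augmentation f = 0"
  shows "f \<cdot> x \<in> N"
proof -
  interpret Module.module laurent_ring laurent_module by (rule module_laurent_module)
  have minus: "\<ominus>\<^bsub>laurent_module\<^esub> f = - f" for f
    by (rule M.minus_equality) (simp_all add: laurent_module_def)
  have "submodule {f. f \<cdot> x \<in> N} laurent_ring laurent_module"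
  proof (rule submoduleI)
    show "\<ominus>\<^bsub>laurent_module\<^esub> f \<in> {f. f \<cdot> x \<in> N}" if "f \<in> {f. f \<cdot> x \<in> N}" for f
      using free.subspace_neg[OF N] that by (simp add: minus)
    show "f \<oplus>\<^bsub>laurent_module\<^esub> g \<in> {f. f \<cdot> x \<in> N}"
      if "f \<in> {f. f \<cdot> x \<in> N}" "g \<in> {f. f \<cdot> x \<in> N}" for f g
      using free.subspace_add[OF N] that by (simp add: laurent_module_def free.scale_left_distrib)
    show "c \<odot>\<^bsub>laurent_module\<^esub> f \<in> {f. f \<cdot> x \<in> N}" if "f \<in> {f. f \<cdot> x \<in> N}" for c f
      using free.subspace_scale[OF N, of _ c] that
      by (simp add: laurent_module_def flip: free.scale_scale)
  qed (use free.subspace_0[OF N] in \<open>simp_all add: laurent_module_def\<close>)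
  with x have "submodule_generated laurent_ring laurent_module {1 - q} \<subseteq> {f. f \<cdot> x \<in> N}"
    by (auto simp: submodule_generated_def)
  with f show ?thesis
    by (auto simp: submodule_generated_one_minus_q)
qed

abbreviation thompson_relators :: "(nat \<Rightarrow>\<^sub>0 laurent) set"
  where "thompson_relators \<equiv> alexander_relators thompson_relations"

lemma thompson_relator:
  assumes "j < k"
  shows "(1 - q) \<cdot> basis j + q \<cdot> basis k - basis (Suc k) \<in> thompson_relators"
proof -
  have "(Act (Gen j) (Gen k), Gen (Suc k)) \<in> thompson_relations"
    using assms by (auto simp: thompson_relations_def)
  from alexander_word_cong[OF quandle_cong.rel[OF this]] show ?thesis by simp
qed

text \<open>Both generators send \<open>p\<^sub>k\<close> to \<open>p\<^bsub>k + 1\<^esub>\<close> as soon as \<open>k\<close> exceeds their indices; comparing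
  the two relations cancels \<open>q p\<^sub>k\<close> and \<open>p\<^bsub>k + 1\<^esub>\<close>.\<close>

lemma thompson_one_minus_q:
  "(1 - q) \<cdot> (basis i - basis j) \<in> thompson_relators"
proof -
  let ?k = "Suc (max i j)"
  have "i < ?k" "j < ?k" by auto
  from relators_diff[OF this[THEN thompson_relator]] show ?thesis
    by (simp add: free.scale_right_diff_distrib)
qed

text \<open>Modulo \<open>(1 - q) (p\<^sub>0 - p\<^sub>k)\<close>, the relation \<open>(1 - q) p\<^sub>0 + q p\<^sub>k = p\<^bsub>k + 1\<^esub>\<close>
  reads \<open>p\<^sub>k = p\<^bsub>k + 1\<^esub>\<close>. It needs \<open>0 < k\<close>, which is why \<open>p\<^sub>0\<close> stays apart.\<close>

lemma thompson_generators_agree: "basis (Suc k) - basis 1 \<in> thompson_relators"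
proof (induction k)
  case (Suc k)
  have "basis (Suc k) - basis (Suc (Suc k)) \<in> thompson_relators"
    using relators_diff[OF thompson_relator[of 0 "Suc k"] thompson_one_minus_q[of 0 "Suc k"]]
    by (simp add: free.scale_right_diff_distrib free.scale_left_diff_distrib algebra_simps)
  from relators_diff[OF Suc this] show ?case by simp
qed (simp add: relators_zero)

definition thompson_section :: "laurent \<times> int \<Rightarrow> (nat \<Rightarrow>\<^sub>0 laurent)"
  where "thompson_section = (\<lambda>(a, n). a \<cdot> basis 0 + of_int n \<cdot> (basis 1 - basis 0))"

lemma augmentation_of_int [simp]: "augmentation (of_int n) = n"
  by (induction n rule: int_induct[of _ 0]) (simp_all add: augmentation_add augmentation_diff)

context
  fixes F :: "(nat \<Rightarrow>\<^sub>0 laurent) \<Rightarrow> laurent \<times> int"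
  assumes F: "Modules.module_hom scale (module.smult thompson_target) F"
    and F_basis: "\<And>k. F (basis k) = (1, if k = 0 then 0 else 1)"
begin

interpretation F: Modules.module_hom scale "module.smult thompson_target" F by (rule F)

lemma thompson_map_section: "F (thompson_section y) = y"
  by (cases y)
    (simp add: thompson_section_def F.add F.scale F.diff F_basis thompson_target_simps del: single_one)

text \<open>The section is additive, but it commutes with scalars only modulo relators: \<open>c\<close> and
  the constant \<open>augmentation c\<close> have the same effect on \<open>p\<^sub>1 - p\<^sub>0\<close>.\<close>

lemma thompson_section_map: "x - thompson_section (F x) \<in> thompson_relators"
proof -
  have section_add: "thompson_section (y + z) = thompson_section y + thompson_section z" for y z
    by (cases y; cases z) (simp add: thompson_section_def free.scale_left_distrib)
  have section_scale: "c \<cdot> thompson_section y - thompson_section (c \<odot>\<^bsub>thompson_target\<^esub> y)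
      \<in> thompson_relators" for c y
  proof (cases y)
    case (Pair a n)
    have "(c * of_int n - of_int (augmentation c * n)) \<cdot> (basis 1 - basis 0) \<in> thompson_relators"
      by (rule scale_mem_of_one_minus_q[OF subspace_alexander_relators thompson_one_minus_q])
        (simp add: augmentation_diff augmentation_mult del: of_int_mult)
    then show ?thesis
      by (simp add: Pair thompson_section_def thompson_target_simps free.scale_right_distrib
          free.scale_left_diff_distrib)
  qed
  show ?thesis
  proof (induction x rule: free_module_induct)
    case (basis k)
    show ?case
      using thompson_generators_agree
      by (cases k) (simp_all add: F_basis thompson_section_def relators_zero del: single_one)
  next
    case (add x y)
    then show ?case
      using relators_add[OF add] by (simp add: F.add section_add algebra_simps)
  next
    case (scale c x)
    have "c \<cdot> x - c \<cdot> thompson_section (F x) \<in> thompson_relators"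
      using relators_scale[OF scale, of c] by (simp add: free.scale_right_diff_distrib)
    from relators_trans[OF this section_scale] show ?case by (simp add: F.scale)
  qed
qed

lemma thompson_relators_eq_kernel: "thompson_relators = {x. F x = 0}"
proof
  have "F (alexander_word u - alexander_word v) = 0" if "(u, v) \<in> thompson_relations" for u v
    using that
    by (auto simp: thompson_relations_def F.diff F.add F.scale F_basis thompson_target_simps
        augmentation_diff zero_prod_def)
  then show "thompson_relators \<subseteq> {x. F x = 0}"
    unfolding alexander_relators_def by (intro free.span_minimal F.subspace_kernel) auto
  show "{x. F x = 0} \<subseteq> thompson_relators"
  proof
    fix x assume "x \<in> {x. F x = 0}"
    then show "x \<in> thompson_relators"
      using thompson_section_map[of x] by (simp add: thompson_section_def zero_prod_def)
  qed
qed

end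

lemma thompson_linear_map:
  obtains F where "Modules.module_hom scale (module.smult thompson_target) F" "surj F"
    "thompson_relators = {x. F x = 0}"
proof -
  obtain F :: "(nat \<Rightarrow>\<^sub>0 laurent) \<Rightarrow> laurent \<times> int"
    where F: "Modules.module_hom scale (module.smult thompson_target) F"
      "\<And>k. F (basis k) = (1, if k = 0 then 0 else 1)"
    by (rule linear_extension_exists[OF target.module_axioms,
          of "\<lambda>k. (1, if k = 0 then 0 else 1)"]) blast
  have "surj F"
    by (metis thompson_map_section[OF F] surjI)
  with F(1) show thesis
    using thompson_relators_eq_kernel[OF F] by (rule that)
qed

theorem proposition7p1:
  fixes R :: "('s quandle_word \<times> 's quandle_word) set"
  assumes "presented_quandle R \<cong>\<^sub>Q thompson_quandle"
  shows "module_isomorphic laurent_ring (alexander_module R) (laurent_module \<oplus>\<^sub>M int_module)"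
proof -
  obtain F where F: "Modules.module_hom scale (module.smult thompson_target) F" "surj F"
    "thompson_relators = {x. F x = 0}"
    by (rule thompson_linear_map)
  obtain G :: "('s \<Rightarrow>\<^sub>0 laurent) \<Rightarrow> laurent \<times> int"
    where G: "Modules.module_hom scale (module.smult thompson_target) G" "surj G"
      "alexander_relators R = {x. G x = 0}"
    by (rule alexander_surjection_transfer[OF assms[unfolded thompson_quandle_def] F])
  show ?thesis
    unfolding alexander_module_eq G(3)
    by (rule quotient_free_module_isomorphic[OF thompson_target_simps(1,2) G(1,2)])
qed

end
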